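(* Let $\Bbbk$ be a field of characteristic zero and let $a,c\in\Bbbk$ with $ac\neq 1$. Let $n,m\in\mathbb{N}$ with $n$ odd, and let $e_0,\dots,e_m\in\Bbbk$. The following identities hold in $Q(a,-1,c)$. (1) If $m$ is even, then $$y^{n}\Big(\sum_{j=0}^{m}e_{j}x^{m-j}y^{j}\Big)=\sum_{j=0}^{m}(-1)^{j}e_{j}x^{m-j}y^{n+j}+\sum_{j=0}^{\frac{m}{2}-1}e_{2j+1}\left(ax^{m-2j}y^{n+2j}+cx^{m-(2j+2)}y^{n+(2j+2)}\right).$$ (2) If $m$ is odd, then $$y^{n}\Big(\sum_{j=0}^{m}e_{j}x^{m-j}y^{j}\Big)=\sum_{j=0}^{\lfloor m/2\rfloor}e_{2j}\left(ax^{m-2j+1}y^{2j+n-1}-x^{m-2j}y^{2j+n}+cx^{m-(2j+1)}y^{2j+n+1}\right)+\sum_{j=0}^{\lfloor m/2\rfloor}e_{2j+1}x^{m-(2j+1)}y^{n+(2j+1)}.$$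
   Context: $\mathbb{N}$ includes $0$; empty sums are zero; $\lfloor\cdot\rfloor$ is the floor function. For $a,b,c\in\Bbbk$, $Q(a,b,c)$ denotes the associative unital $\Bbbk$-algebra generated by $x,y$ subject to the single relation $yx=ax^{2}+bxy+cy^{2}$. Thus in $Q(a,-1,c)$ the relation is $yx=ax^2-xy+cy^2$. When $ac\ne 1$ the set $\{x^{i}y^{j}\mid i,j\in\mathbb{N}\}$ is a $\Bbbk$-basis (PBW basis) of $Q(a,-1,c)$. *)

theory Defs
  imports
    "HOL-Algebra.Algebra"
    "HOL-Algebra.Algebraic_Closure_Type"
    "HOL-Library.Poly_Mapping"
begin

section \<open>The free algebra on two generators\<close>

datatype gen = Gen_x | Gen_y

text \<open>
  Words form the free monoid on the generators. It is written additively (zero is the empty word,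
  plus is concatenation) because the convolution product of \<^type>\<open>poly_mapping\<close> is indexed by an
  additive monoid, which need not be commutative.
\<close>

datatype word = Word "gen list"

instantiation word :: monoid_add
begin

definition zero_word :: word where
  "0 = Word []"

fun plus_word :: "word \<Rightarrow> word \<Rightarrow> word" where
  "Word u + Word v = Word (u @ v)"

instance
proof
  fix u v w :: word
  show "u + v + w = u + (v + w)"
    by (cases u; cases v; cases w) simp
  show "0 + u = u"
    by (cases u) (simp add: zero_word_def)
  show "u + 0 = u"
    by (cases u) (simp add: zero_word_def)
qed

end

text \<open>Monoid algebra of the free monoid, with the convolution product of \<^type>\<open>poly_mapping\<close>.\<close>

type_synonym 'k free_alg = "word \<Rightarrow>\<^sub>0 'k"

definition free_gen :: "gen \<Rightarrow> 'k::field free_alg" where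
  "free_gen g = Poly_Mapping.single (Word [g]) 1"

definition free_const :: "'k::field \<Rightarrow> 'k free_alg" where
  "free_const k = Poly_Mapping.single 0 k"

abbreviation free_ring :: "'k::field free_alg ring" where
  "free_ring \<equiv> ring_of_type_algebra"


section \<open>The algebra Q(a,b,c)\<close>

definition Q_relator :: "'k::field \<Rightarrow> 'k \<Rightarrow> 'k \<Rightarrow> 'k free_alg" where
  "Q_relator a b c =
     (let x = free_gen Gen_x; y = free_gen Gen_y
      in y * x - (free_const a * x ^ 2 + free_const b * (x * y) + free_const c * y ^ 2))"

definition Q_ideal :: "'k::field \<Rightarrow> 'k \<Rightarrow> 'k \<Rightarrow> 'k free_alg set" where
  "Q_ideal a b c = Idl\<^bsub>free_ring\<^esub> {Q_relator a b c}"

text \<open>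
  The quotient ring of the free algebra by the two-sided ideal generated by the relator, together
  with the induced scalar multiplication. Elements are cosets; scalar multiplication is defined on
  representatives in the same style as \<^const>\<open>rcoset_mult\<close>.
\<close>

definition Q_alg :: "'k::field \<Rightarrow> 'k \<Rightarrow> 'k \<Rightarrow> ('k, 'k free_alg set) module" where
  "Q_alg a b c =
     (let I = Q_ideal a b c; F = free_ring Quot I
      in \<lparr>carrier = carrier F, monoid.mult = monoid.mult F, one = one F,
          ring.zero = ring.zero F, add = add F,
          module.smult = (\<lambda>k A. \<Union>f\<in>A. I +>\<^bsub>free_ring\<^esub> (free_const k * f))\<rparr>)"

definition Q_gen :: "'k::field \<Rightarrow> 'k \<Rightarrow> 'k \<Rightarrow> gen \<Rightarrow> 'k free_alg set" where
  "Q_gen a b c g = Q_ideal a b c +>\<^bsub>free_ring\<^esub> free_gen g"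


section \<open>Q(a,b,c) is an associative unital algebra satisfying the defining relation\<close>

text \<open>The \<open>algebra\<close> locale of HOL-Algebra requires commutativity, so the laws are stated separately.\<close>

lemma ring_ring_of_type_algebra: "ring (ring_of_type_algebra :: 'a::ring_1 ring)"
proof -
  have "\<exists>y. x + y = 0" for x :: 'a
    using add.right_inverse by blast
  thus ?thesis
    unfolding ring_of_type_algebra_def using add.right_inverse
    by unfold_locales (auto simp: algebra_simps Units_def)
qed

lemma ring_of_type_algebra_simps [simp]:
  "carrier ring_of_type_algebra = UNIV" "monoid.mult ring_of_type_algebra = (*)"
  "one ring_of_type_algebra = 1" "ring.zero ring_of_type_algebra = 0"
  "add ring_of_type_algebra = (+)"
  by (simp_all add: ring_of_type_algebra_def)

lemma Q_ideal_ideal: "ideal (Q_ideal a b c) free_ring"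
  unfolding Q_ideal_def
  by (rule ring.genideal_ideal[OF ring_ring_of_type_algebra]) simp

lemma free_const_commute: "free_const k * f = f * free_const k"
proof -
  have *: "Poly_Mapping.single 0 k * Poly_Mapping.single w r =
      Poly_Mapping.single w r * Poly_Mapping.single (0::word) (k::'a)" for w r
    by (simp add: mult_single mult.commute)
  show ?thesis
    unfolding free_const_def
  proof (induction f rule: update_induct)
    case (update f w r)
    then have "Poly_Mapping.update w r f = f + Poly_Mapping.single w r"
      by (intro poly_mapping_eqI) (auto simp: lookup_update lookup_add lookup_single in_keys_iff when_def)
    with update * show ?case
      by (simp add: distrib_left distrib_right)
  qed simp
qed

lemma Q_coset:
  fixes a b c :: "'k::field"
  defines "\<pi> \<equiv> \<lambda>f. Q_ideal a b c +>\<^bsub>free_ring\<^esub> f" and "Q \<equiv> Q_alg a b c"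
  shows Q_carrier: "carrier Q = range \<pi>"
    and Q_mult: "\<pi> f \<otimes>\<^bsub>Q\<^esub> \<pi> g = \<pi> (f * g)"
    and Q_add: "\<pi> f \<oplus>\<^bsub>Q\<^esub> \<pi> g = \<pi> (f + g)"
    and Q_one: "\<one>\<^bsub>Q\<^esub> = \<pi> 1"
    and Q_zero: "\<zero>\<^bsub>Q\<^esub> = \<pi> 0"
    and Q_smult: "k \<odot>\<^bsub>Q\<^esub> \<pi> f = \<pi> (free_const k * f)"
proof -
  interpret ideal "Q_ideal a b c" free_ring by (rule Q_ideal_ideal)
  show "carrier Q = range \<pi>"
    by (auto simp: Q_def \<pi>_def Q_alg_def Let_def FactRing_def A_RCOSETS_def RCOSETS_def a_r_coset_def)
  show "\<pi> f \<otimes>\<^bsub>Q\<^esub> \<pi> g = \<pi> (f * g)"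
    using rcoset_mult_add[of f g] by (simp add: Q_def \<pi>_def Q_alg_def Let_def FactRing_def)
  show "\<pi> f \<oplus>\<^bsub>Q\<^esub> \<pi> g = \<pi> (f + g)"
    using a_rcos_sum[of f g] by (simp add: Q_def \<pi>_def Q_alg_def Let_def FactRing_def)
  show "\<one>\<^bsub>Q\<^esub> = \<pi> 1"
    by (simp add: Q_def \<pi>_def Q_alg_def Let_def FactRing_def)
  show "\<zero>\<^bsub>Q\<^esub> = \<pi> 0"
    using a_rcos_zero[OF Q_ideal_ideal, of 0 a b c]
      additive_subgroup.zero_closed[OF ideal.axioms(1)[OF Q_ideal_ideal], of a b c]
    by (simp add: Q_def \<pi>_def Q_alg_def Let_def FactRing_def)
  have "\<pi> (free_const k * f') = \<pi> (free_const k * f)" if "f' \<in> \<pi> f" for f'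
  proof -
    have "\<pi> f' = \<pi> f"
      using that a_repr_independence'[of f' f] by (simp add: \<pi>_def)
    then show ?thesis
      using rcoset_mult_add[of "free_const k" f] rcoset_mult_add[of "free_const k" f']
      by (simp add: \<pi>_def)
  qed
  moreover have "f \<in> \<pi> f"
    using a_rcos_self[of f] by (simp add: \<pi>_def)
  ultimately have "(\<Union>f'\<in>\<pi> f. \<pi> (free_const k * f')) = \<pi> (free_const k * f)"
    by blast
  then show "k \<odot>\<^bsub>Q\<^esub> \<pi> f = \<pi> (free_const k * f)"
    by (simp add: Q_def \<pi>_def Q_alg_def Let_def)
qed

lemma Q_ring: "ring (Q_alg a b c)"
proof -
  interpret R: ring "free_ring Quot Q_ideal a b c"
    by (rule ideal.quotient_is_ring[OF Q_ideal_ideal])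
  show ?thesis
    by (rule ringI; (rule abelian_groupI monoidI)?)
      (auto simp: Q_alg_def Let_def R.m_assoc R.a_assoc R.l_distr R.r_distr R.a_comm R.a_lcomm
        intro: R.add.l_inv_ex)
qed

lemma Q_module: "module (ring_of_type_algebra :: 'k::field ring) (Q_alg a b c)"
proof (rule moduleI)
  show "cring (ring_of_type_algebra :: 'k ring)" ..
  show "abelian_group (Q_alg a b c)"
    using Q_ring by (rule ring.is_abelian_group)
qed (auto simp: Q_coset free_const_def mult_single single_add
    algebra_simps simp flip: mult.assoc)

lemma Q_smult_assoc:
  assumes "u \<in> carrier (Q_alg a b c)" "v \<in> carrier (Q_alg a b c)"
  shows "(k \<odot>\<^bsub>Q_alg a b c\<^esub> u) \<otimes>\<^bsub>Q_alg a b c\<^esub> v = k \<odot>\<^bsub>Q_alg a b c\<^esub> (u \<otimes>\<^bsub>Q_alg a b c\<^esub> v)"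
    and "u \<otimes>\<^bsub>Q_alg a b c\<^esub> (k \<odot>\<^bsub>Q_alg a b c\<^esub> v) = k \<odot>\<^bsub>Q_alg a b c\<^esub> (u \<otimes>\<^bsub>Q_alg a b c\<^esub> v)"
  using assms by (auto simp: Q_coset mult.assoc free_const_commute)

lemma Q_relation:
  fixes a b c :: "'k::field" and Q (structure)
  defines "Q \<equiv> Q_alg a b c" and "x \<equiv> Q_gen a b c Gen_x" and "y \<equiv> Q_gen a b c Gen_y"
  shows "y \<otimes> x = a \<odot> (x [^] (2::nat)) \<oplus> b \<odot> (x \<otimes> y) \<oplus> c \<odot> (y [^] (2::nat))"
proof -
  interpret ideal "Q_ideal a b c" free_ring by (rule Q_ideal_ideal)
  interpret Q: ring Q unfolding Q_def by (rule Q_ring)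
  let ?x = "free_gen Gen_x :: 'k free_alg" and ?y = "free_gen Gen_y :: 'k free_alg"
  let ?g = "free_const a * ?x ^ 2 + free_const b * (?x * ?y) + free_const c * ?y ^ 2"
  have "Q_relator a b c \<in> Q_ideal a b c"
    unfolding Q_ideal_def
    by (rule ring.genideal_self'[OF ring_ring_of_type_algebra]) simp
  then have "?y * ?x \<in> Q_ideal a b c +>\<^bsub>free_ring\<^esub> ?g"
    by (auto simp: a_r_coset_def r_coset_def Q_relator_def Let_def
        intro!: bexI[of _ "Q_relator a b c"])
  then have "Q_ideal a b c +>\<^bsub>free_ring\<^esub> (?y * ?x) = Q_ideal a b c +>\<^bsub>free_ring\<^esub> ?g"
    by (intro a_repr_independence'[symmetric]) simp_all
  moreover have "x \<in> carrier Q" "y \<in> carrier Q"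
    by (simp_all add: x_def y_def Q_gen_def Q_def Q_coset)
  ultimately show ?thesis
    by (simp add: numeral_2_eq_2) (simp add: Q_def x_def y_def Q_gen_def Q_coset numeral_2_eq_2)
qed

end

theory Submission
  imports Defs
begin

text \<open>
  Subtracting the left and right multiples of \<open>y x + x y = a x\<^sup>2 + c y\<^sup>2\<close> by \<open>y\<close> and by \<open>x\<close> gives
  \<open>[y\<^sup>2, x] = a [y, x\<^sup>2]\<close> and \<open>[y, x\<^sup>2] = c [y\<^sup>2, x]\<close>. Since \<open>a c \<noteq> 1\<close>, both commutators vanish,
  so \<open>x\<^sup>2\<close> and \<open>y\<^sup>2\<close> are central. Hence, for odd \<open>n\<close>, \<open>y\<^sup>n x\<^sup>k\<close> equals \<open>x\<^sup>k y\<^sup>n\<close> if \<open>k\<close> is even, while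
  for odd \<open>k\<close> a single application of the relation remains. The sums are split by the parity of \<open>j\<close>.
\<close>

section \<open>Commutation in monoids and parity splitting of finite sums\<close>

lemma (in monoid) commutes_mult:
  assumes "u \<otimes> w = w \<otimes> u" "v \<otimes> w = w \<otimes> v"
    and [simp]: "u \<in> carrier G" "v \<in> carrier G" "w \<in> carrier G"
  shows "(u \<otimes> v) \<otimes> w = w \<otimes> (u \<otimes> v)"
proof -
  have "(u \<otimes> v) \<otimes> w = (u \<otimes> w) \<otimes> v"
    using assms(2) by (simp add: m_assoc)
  then show ?thesis
    using assms(1) by (simp add: m_assoc)
qed

context abelian_monoid
begin

lemma finsum_parity_split_odd:
  fixes k :: nat
  assumes "f \<in> UNIV \<rightarrow> carrier G"
  shows "finsum G f {0..2 * k + 1} =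
    (\<Oplus>j\<in>{0..k}. f (2 * j)) \<oplus> (\<Oplus>j\<in>{0..k}. f (2 * j + 1))"
proof (induction k)
  case 0
  have "{0..Suc 0} = {0, 1}" by auto
  with assms show ?case by (simp add: Pi_def)
next
  case (Suc k)
  have [simp]: "f i \<in> carrier G" for i using assms by auto
  have "{0..2 * Suc k + 1} =
      insert (2 * Suc k + 1) (insert (2 * Suc k) {0..2 * k + 1})" by auto
  then have "finsum G f {0..2 * Suc k + 1} =
      f (2 * Suc k + 1) \<oplus> (f (2 * Suc k) \<oplus> finsum G f {0..2 * k + 1})"
    by (simp add: Pi_def del: atLeastAtMost_iff) auto
  then show ?case
    unfolding Suc.IH by (simp add: atLeast0_atMost_Suc Pi_def a_ac)
qed

text \<open>The top index \<open>2 * k\<close> is even, so removing it reduces the claim to the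
  odd-length split. The odd indices are one fewer than the even ones; the half-open range
  \<open>{0..<k}\<close> expresses this correctly also for \<open>k = 0\<close>.\<close>

lemma finsum_parity_split_even:
  fixes k :: nat
  assumes "f \<in> UNIV \<rightarrow> carrier G"
  shows "finsum G f {0..2 * k} =
    (\<Oplus>j\<in>{0..k}. f (2 * j)) \<oplus> (\<Oplus>j\<in>{0..<k}. f (2 * j + 1))"
proof (cases k)
  case 0
  with assms show ?thesis by (simp add: Pi_def)
next
  case (Suc l)
  have "f i \<in> carrier G" for i using assms by auto
  moreover have "{0..2 * k} = insert (2 * k) {0..2 * l + 1}"
    and "{0..k} = insert k {0..l}" and "{0..<k} = {0..l}"
    using Suc by auto
  ultimately show ?thesis
    using finsum_parity_split_odd[OF assms, of l] Suc by (simp add: Pi_def a_ac)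
qed

end

section \<open>Associative algebras over a field\<close>

text \<open>Multiplication need not commute, so compatibility with scalars is assumed in each factor
  separately. Working abstractly keeps cosets out of the calculations.\<close>

locale assoc_algebra =
  module "ring_of_type_algebra :: 'k ring" A + A?: ring A
  for A :: "('k::field, 'b) module" (structure) +
  assumes smult_mult_left: "u \<in> carrier A \<Longrightarrow> v \<in> carrier A \<Longrightarrow> (k \<odot> u) \<otimes> v = k \<odot> (u \<otimes> v)"
    and smult_mult_right: "u \<in> carrier A \<Longrightarrow> v \<in> carrier A \<Longrightarrow> u \<otimes> (k \<odot> v) = k \<odot> (u \<otimes> v)"
begin

lemmas smult_simps [simp] =
  smult_closed[simplified] smult_mult_left smult_mult_right smult_r_distr[simplified]

lemma smult_smult: "u \<in> carrier A \<Longrightarrow> k \<odot> (l \<odot> u) = (k * l) \<odot> u"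
  using smult_assoc1[of k l u] by simp

lemma smult_uminus_left:
  assumes "u \<in> carrier A"
  shows "(- k) \<odot> u = \<ominus> (k \<odot> u)"
proof -
  have "(- k) \<odot> u \<oplus> k \<odot> u = \<zero>"
    using assms smult_l_distr[of "- k" k u] smult_l_null[of u] by simp
  then show ?thesis
    using assms by (simp add: minus_equality)
qed

lemma smult_minus_right:
  assumes "u \<in> carrier A" "v \<in> carrier A"
  shows "k \<odot> (u \<ominus> v) = k \<odot> u \<ominus> k \<odot> v"
  using assms smult_r_minus[of k v] by (simp add: minus_eq)

end

section \<open>Commutation of the squares with \<open>x\<close> and \<open>y\<close>\<close>

locale skew_relation = assoc_algebra A for A :: "('k::field, 'b) module" (structure) +
  fixes a c :: 'k and x y :: 'b
  assumes x_closed [simp]: "x \<in> carrier A" and y_closed [simp]: "y \<in> carrier A"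
    and relation: "y \<otimes> x = a \<odot> (x \<otimes> x) \<ominus> x \<otimes> y \<oplus> c \<odot> (y \<otimes> y)"
    and ac: "a * c \<noteq> 1"
begin

text \<open>Multiply the relation by \<open>x\<close> on the right and rewrite the resulting
  \<open>x \<otimes> (y \<otimes> x)\<close> by the relation again: the cubes of \<open>x\<close>
  cancel, and so does \<open>x \<otimes> x \<otimes> y\<close>.\<close>

lemma commutator_y_xx:
  "y \<otimes> (x \<otimes> x) \<ominus> (x \<otimes> x) \<otimes> y = c \<odot> ((y \<otimes> y) \<otimes> x \<ominus> x \<otimes> (y \<otimes> y))"
proof -
  have cancel: "t \<ominus> (t \<ominus> u \<oplus> v) \<oplus> w \<ominus> u = w \<ominus> v"
    if "t \<in> carrier A" "u \<in> carrier A" "v \<in> carrier A" "w \<in> carrier A" for t u v w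
    using that by algebra
  have "y \<otimes> (x \<otimes> x) = (a \<odot> (x \<otimes> x) \<ominus> x \<otimes> y \<oplus> c \<odot> (y \<otimes> y)) \<otimes> x"
    by (simp flip: relation m_assoc)
  also have "\<dots> = a \<odot> (x \<otimes> (x \<otimes> x)) \<ominus> x \<otimes> (y \<otimes> x) \<oplus> c \<odot> (y \<otimes> y \<otimes> x)"
    by (simp add: minus_eq l_distr l_minus m_assoc)
  also have "x \<otimes> (y \<otimes> x) =
      a \<odot> (x \<otimes> (x \<otimes> x)) \<ominus> x \<otimes> x \<otimes> y \<oplus> c \<odot> (x \<otimes> (y \<otimes> y))"
    by (simp add: relation minus_eq r_distr r_minus m_assoc)
  finally show ?thesis
    by (simp add: cancel smult_minus_right)
qed

text \<open>Mirror image of \<open>commutator_y_xx\<close>: multiply by \<open>y\<close> on the left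
  and expand \<open>y \<otimes> x \<otimes> y\<close>; now the cubes of \<open>y\<close>
  cancel.\<close>

lemma commutator_yy_x:
  "(y \<otimes> y) \<otimes> x \<ominus> x \<otimes> (y \<otimes> y) = a \<odot> (y \<otimes> (x \<otimes> x) \<ominus> (x \<otimes> x) \<otimes> y)"
proof -
  have cancel: "p \<ominus> (q \<ominus> r \<oplus> s) \<oplus> s \<ominus> r = p \<ominus> q"
    if "p \<in> carrier A" "q \<in> carrier A" "r \<in> carrier A" "s \<in> carrier A" for p q r s
    using that by algebra
  have "(y \<otimes> y) \<otimes> x = y \<otimes> (a \<odot> (x \<otimes> x) \<ominus> x \<otimes> y \<oplus> c \<odot> (y \<otimes> y))"
    by (simp flip: relation add: m_assoc)
  also have "\<dots> = a \<odot> (y \<otimes> (x \<otimes> x)) \<ominus> y \<otimes> x \<otimes> y \<oplus> c \<odot> (y \<otimes> (y \<otimes> y))"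
    by (simp add: minus_eq r_distr r_minus m_assoc)
  also have "y \<otimes> x \<otimes> y =
      a \<odot> (x \<otimes> x \<otimes> y) \<ominus> x \<otimes> (y \<otimes> y) \<oplus> c \<odot> (y \<otimes> (y \<otimes> y))"
    by (simp add: relation minus_eq l_distr l_minus m_assoc)
  finally show ?thesis
    by (simp add: cancel smult_minus_right)
qed

lemma yy_commutes: "(y \<otimes> y) \<otimes> x = x \<otimes> (y \<otimes> y)"
proof -
  define D where "D = (y \<otimes> y) \<otimes> x \<ominus> x \<otimes> (y \<otimes> y)"
  have D [simp]: "D \<in> carrier A" by (simp add: D_def)
  have "D = (a * c) \<odot> D"
    using commutator_yy_x unfolding commutator_y_xx D_def[symmetric] by (simp add: smult_smult)
  \<comment> \<open>By distributivity the left side is \<open>D\<close>, so this is the previous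
    equation with a common summand ready to cancel. The remaining scalar \<open>1 - a * c\<close> is
    a unit of the field.\<close>
  then have "(1 - a * c) \<odot> D \<oplus> (a * c) \<odot> D = \<zero> \<oplus> (a * c) \<odot> D"
    using smult_l_distr[of "1 - a * c" "a * c" D] smult_one[of D] by simp
  then have "(1 - a * c) \<odot> D = \<zero>"
    by (simp add: add.right_cancel)
  then have "inverse (1 - a * c) \<odot> ((1 - a * c) \<odot> D) = \<zero>"
    using smult_r_null by simp
  then have "D = \<zero>"
    using ac smult_one[of D] by (simp add: smult_smult)
  then show ?thesis
    by (simp add: D_def)
qed

text \<open>By \<open>commutator_y_xx\<close> this commutator is a multiple of the one that
  \<open>yy_commutes\<close> annihilates.\<close>

lemma xx_commutes: "(x \<otimes> x) \<otimes> y = y \<otimes> (x \<otimes> x)"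
proof -
  have *: "x \<otimes> (y \<otimes> y) \<ominus> x \<otimes> (y \<otimes> y) = \<zero>"
    by (simp add: minus_eq r_neg)
  show ?thesis
    using commutator_y_xx by (simp add: yy_commutes *)
qed

section \<open>Moving powers of \<open>y\<close> past powers of \<open>x\<close>\<close>

lemma even_pow_x_commutes:
  fixes k :: nat
  assumes "even k"
  shows "x [^] k \<otimes> y = y \<otimes> x [^] k"
proof -
  obtain q where "k = 2 * q" using assms ..
  then have "x [^] k = (x \<otimes> x) [^] q"
    using nat_pow_pow[of x 2 q] by (simp add: numeral_2_eq_2)
  then show ?thesis
    using group_commutes_pow[OF xx_commutes] by simp
qed

lemma even_pow_y_commutes:
  fixes k :: nat
  assumes "even k"
  shows "y [^] k \<otimes> x = x \<otimes> y [^] k"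
proof -
  obtain q where "k = 2 * q" using assms ..
  then have "y [^] k = (y \<otimes> y) [^] q"
    using nat_pow_pow[of y 2 q] by (simp add: numeral_2_eq_2)
  then show ?thesis
    using group_commutes_pow[OF yy_commutes] by simp
qed

lemma pow_y_pow_x_even:
  fixes n k :: nat
  assumes "even k"
  shows "y [^] n \<otimes> x [^] k = x [^] k \<otimes> y [^] n"
  by (rule group_commutes_pow[OF even_pow_x_commutes[OF assms, symmetric]]) simp_all

text \<open>Split off one \<open>y\<close> and one \<open>x\<close>. The remaining even powers
  commute with both generators, so they move outside the single product
  \<open>y \<otimes> x\<close>, to which the relation is applied once.\<close>

lemma pow_y_pow_x_odd:
  fixes n k :: nat
  assumes "odd n" "odd k"
  shows "y [^] n \<otimes> x [^] k = a \<odot> (x [^] (k + 1) \<otimes> y [^] (n - 1))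
    \<ominus> x [^] k \<otimes> y [^] n \<oplus> c \<odot> (x [^] (k - 1) \<otimes> y [^] (n + 1))"
proof -
  obtain p q where n: "n = Suc p" "even p" and k: "k = Suc q" "even q"
    using assms by (metis Suc_pred even_Suc odd_pos)
  let ?X = "x [^] q" and ?Y = "y [^] p"
  have pow_Suc2: "u [^] Suc i = u \<otimes> u [^] i" if "u \<in> carrier A" for u and i :: nat
    using that by (rule nat_pow_Suc2)
  have "y [^] n \<otimes> x [^] k = ?Y \<otimes> y \<otimes> (?X \<otimes> x)"
    by (simp add: n k)
  also have x_pow: "?X \<otimes> x = x \<otimes> ?X"
    by (simp add: pow_mult_distrib group_commutes_pow)
  also have "?Y \<otimes> y \<otimes> (x \<otimes> ?X) = ?Y \<otimes> (y \<otimes> x \<otimes> ?X)"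
    by (simp add: m_assoc)
  \<comment> \<open>\<open>?X\<close> commutes with \<open>y\<close> because \<open>q\<close> is
    even, and with \<open>x\<close> as a power of \<open>x\<close>.\<close>
  also have "y \<otimes> x \<otimes> ?X = ?X \<otimes> (y \<otimes> x)"
    using even_pow_x_commutes[OF k(2)] x_pow
    by (intro commutes_mult) simp_all
  also have "?Y \<otimes> (?X \<otimes> (y \<otimes> x)) = ?X \<otimes> (y \<otimes> x \<otimes> ?Y)"
  proof -
    have "?Y \<otimes> (?X \<otimes> (y \<otimes> x)) = ?X \<otimes> (?Y \<otimes> (y \<otimes> x))"
      using pow_y_pow_x_even[OF k(2), of p] by (simp flip: m_assoc)
    also have "?Y \<otimes> (y \<otimes> x) = y \<otimes> x \<otimes> ?Y"
      using even_pow_y_commutes[OF n(2)] pow_Suc2[of y p]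
      by (intro commutes_mult[symmetric]) simp_all
    finally show ?thesis .
  qed
  also have "\<dots> = a \<odot> (?X \<otimes> x \<otimes> x \<otimes> ?Y)
      \<ominus> ?X \<otimes> x \<otimes> (y \<otimes> ?Y) \<oplus> c \<odot> (?X \<otimes> (y \<otimes> (y \<otimes> ?Y)))"
    by (simp add: relation minus_eq l_distr r_distr l_minus r_minus m_assoc)
  also have "\<dots> = a \<odot> (x [^] (k + 1) \<otimes> y [^] (n - 1))
    \<ominus> x [^] k \<otimes> y [^] n \<oplus> c \<odot> (x [^] (k - 1) \<otimes> y [^] (n + 1))"
    by (simp only: n k pow_Suc2[OF y_closed] nat_pow_Suc[of x] Suc_eq_plus1[symmetric] diff_Suc_1)
  finally show ?thesis .
qed

lemma pow_y_mult_monomial_even: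
  fixes n k j :: nat
  assumes "even k"
  shows "y [^] n \<otimes> (x [^] k \<otimes> y [^] j) = x [^] k \<otimes> y [^] (n + j)"
  using pow_y_pow_x_even[OF assms, of n]
  by (simp flip: m_assoc nat_pow_mult)

lemma pow_y_mult_monomial_odd:
  fixes n k j :: nat
  assumes "odd n" "odd k"
  shows "y [^] n \<otimes> (x [^] k \<otimes> y [^] j) = a \<odot> (x [^] (k + 1) \<otimes> y [^] (n + j - 1))
    \<ominus> x [^] k \<otimes> y [^] (n + j) \<oplus> c \<odot> (x [^] (k - 1) \<otimes> y [^] (n + j + 1))"
proof -
  \<comment> \<open>Oddness gives \<open>n > 0\<close>, so \<open>n + j - 1 = (n - 1) + j\<close>
    holds despite truncated subtraction.\<close>
  have *: "y [^] (n + j - 1) = y [^] (n - 1) \<otimes> y [^] j"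
    "y [^] (n + j + 1) = y [^] (n + 1) \<otimes> y [^] j" "y [^] (n + j) = y [^] n \<otimes> y [^] j"
    using odd_pos[OF assms(1)] by (simp_all only: nat_pow_mult y_closed) simp_all
  have "y [^] n \<otimes> (x [^] k \<otimes> y [^] j) = y [^] n \<otimes> x [^] k \<otimes> y [^] j"
    by (simp add: m_assoc)
  then show ?thesis
    unfolding * pow_y_pow_x_odd[OF assms]
    by (simp add: minus_eq l_distr l_minus m_assoc)
qed

section \<open>Left multiplication of a sum by an odd power of \<open>y\<close>\<close>

lemma pow_y_mult_sum:
  fixes n m :: nat
  shows "y [^] n \<otimes> (\<Oplus>j\<in>{0..m}. e j \<odot> (x [^] (m - j) \<otimes> y [^] j)) =
    (\<Oplus>j\<in>{0..m}. e j \<odot> (y [^] n \<otimes> (x [^] (m - j) \<otimes> y [^] j)))"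
  by (simp add: finsum_rdistr Pi_def)

text \<open>Here \<open>m - j\<close> has the parity of \<open>j\<close>. Terms with even
  \<open>j\<close> pass unchanged; for odd \<open>j\<close> the middle term of
  \<open>pow_y_mult_monomial_odd\<close> supplies the sign \<open>(-1) ^ j\<close>, and its two
  outer terms form the correction \<open>h\<close>.\<close>

lemma pow_y_mult_sum_even:
  fixes n m :: nat
  assumes n: "odd n" and m: "even m"
  shows "y [^] n \<otimes> (\<Oplus>j\<in>{0..m}. e j \<odot> (x [^] (m - j) \<otimes> y [^] j)) =
    (\<Oplus>j\<in>{0..m}. ((-1) ^ j * e j) \<odot> (x [^] (m - j) \<otimes> y [^] (n + j)))
    \<oplus> (\<Oplus>j\<in>{0..<m div 2}. e (2 * j + 1) \<odot>
          (a \<odot> (x [^] (m - 2 * j) \<otimes> y [^] (n + 2 * j))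
           \<oplus> c \<odot> (x [^] (m - (2 * j + 2)) \<otimes> y [^] (n + (2 * j + 2)))))"
proof -
  obtain k where k: "m = 2 * k" using m ..
  define f where "f j = e j \<odot> (y [^] n \<otimes> (x [^] (m - j) \<otimes> y [^] j))" for j
  define g where "g j = ((-1) ^ j * e j) \<odot> (x [^] (m - j) \<otimes> y [^] (n + j))" for j
  define h where "h j = e (2 * j + 1) \<odot>
    (a \<odot> (x [^] (m - 2 * j) \<otimes> y [^] (n + 2 * j))
      \<oplus> c \<odot> (x [^] (m - (2 * j + 2)) \<otimes> y [^] (n + (2 * j + 2))))" for j
  have [simp]: "f j \<in> carrier A" "g j \<in> carrier A" "h j \<in> carrier A" for j
    by (simp_all add: f_def g_def h_def)
  have even_terms: "f (2 * j) = g (2 * j)" for j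
    using pow_y_mult_monomial_even[of "m - 2 * j" n "2 * j"] m by (simp add: f_def g_def)
  \<comment> \<open>The bound gives \<open>2 * j + 2 \<le> m\<close>, so no subtraction truncates
    and \<open>m - (2 * j + 1)\<close> is odd.\<close>
  have odd_terms: "f (2 * j + 1) = g (2 * j + 1) \<oplus> h j" if "j < k" for j
  proof -
    have exps: "m - (2 * j + 1) + 1 = m - 2 * j" "m - (2 * j + 1) - 1 = m - (2 * j + 2)"
      "n + (2 * j + 1) - 1 = n + 2 * j" "n + (2 * j + 1) + 1 = n + (2 * j + 2)"
      using that k by simp_all
    have "odd (m - (2 * j + 1))" using that k by simp
    from pow_y_mult_monomial_odd[OF n this, of "2 * j + 1"]
    show ?thesis
      unfolding f_def g_def h_def exps
      by (simp add: minus_eq smult_uminus_left smult_r_minus[simplified] a_ac del: nat_pow_Suc)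
  qed
  have "(\<Oplus>j\<in>{0..m}. f j) =
      (\<Oplus>j\<in>{0..k}. f (2 * j)) \<oplus> (\<Oplus>j\<in>{0..<k}. f (2 * j + 1))"
    unfolding k by (rule finsum_parity_split_even) simp
  also have "(\<Oplus>j\<in>{0..<k}. f (2 * j + 1)) = (\<Oplus>j\<in>{0..<k}. g (2 * j + 1) \<oplus> h j)"
    by (rule finsum_cong') (simp_all add: odd_terms[simplified])
  also have "\<dots> = (\<Oplus>j\<in>{0..<k}. g (2 * j + 1)) \<oplus> (\<Oplus>j\<in>{0..<k}. h j)"
    by (rule finsum_addf) simp_all
  finally have "(\<Oplus>j\<in>{0..m}. f j) = ((\<Oplus>j\<in>{0..k}. g (2 * j)) \<oplus>
      (\<Oplus>j\<in>{0..<k}. g (2 * j + 1))) \<oplus> (\<Oplus>j\<in>{0..<k}. h j)"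
    by (simp add: even_terms a_assoc)
  also have "(\<Oplus>j\<in>{0..k}. g (2 * j)) \<oplus> (\<Oplus>j\<in>{0..<k}. g (2 * j + 1)) = (\<Oplus>j\<in>{0..m}. g j)"
    unfolding k by (rule finsum_parity_split_even[symmetric]) simp
  finally show ?thesis
    unfolding pow_y_mult_sum f_def g_def h_def by (simp add: k)
qed

text \<open>Now \<open>m - j\<close> is odd exactly for even \<open>j\<close> in the range, so the
  parities swap roles: the even indices give three terms each, the odd ones pass unchanged.\<close>

lemma pow_y_mult_sum_odd:
  fixes n m :: nat
  assumes n: "odd n" and m: "odd m"
  shows "y [^] n \<otimes> (\<Oplus>j\<in>{0..m}. e j \<odot> (x [^] (m - j) \<otimes> y [^] j)) =
    (\<Oplus>j\<in>{0..m div 2}. e (2 * j) \<odot>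
        (a \<odot> (x [^] (m - 2 * j + 1) \<otimes> y [^] (2 * j + n - 1))
         \<ominus> x [^] (m - 2 * j) \<otimes> y [^] (2 * j + n)
         \<oplus> c \<odot> (x [^] (m - (2 * j + 1)) \<otimes> y [^] (2 * j + n + 1))))
    \<oplus> (\<Oplus>j\<in>{0..m div 2}. e (2 * j + 1) \<odot>
        (x [^] (m - (2 * j + 1)) \<otimes> y [^] (n + (2 * j + 1))))"
proof -
  obtain k where k: "m = 2 * k + 1" using m ..
  then have div: "m div 2 = k" by simp
  define f where "f j = e j \<odot> (y [^] n \<otimes> (x [^] (m - j) \<otimes> y [^] j))" for j
  have f_closed [simp]: "f j \<in> carrier A" for j
    by (simp add: f_def)
  have "f (2 * j) = e (2 * j) \<odot>
        (a \<odot> (x [^] (m - 2 * j + 1) \<otimes> y [^] (2 * j + n - 1))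
         \<ominus> x [^] (m - 2 * j) \<otimes> y [^] (2 * j + n)
         \<oplus> c \<odot> (x [^] (m - (2 * j + 1)) \<otimes> y [^] (2 * j + n + 1)))" if "j \<le> k" for j
  proof -
    have odd: "odd (m - 2 * j)" and exp: "m - 2 * j - 1 = m - (2 * j + 1)"
      using that k by simp_all
    show ?thesis
      using pow_y_mult_monomial_odd[OF n odd, of "2 * j"] by (simp only: f_def add.commute[of n] exp)
  qed
  then have even_terms: "(\<Oplus>j\<in>{0..k}. f (2 * j)) = (\<Oplus>j\<in>{0..k}. e (2 * j) \<odot>
        (a \<odot> (x [^] (m - 2 * j + 1) \<otimes> y [^] (2 * j + n - 1))
         \<ominus> x [^] (m - 2 * j) \<otimes> y [^] (2 * j + n)
         \<oplus> c \<odot> (x [^] (m - (2 * j + 1)) \<otimes> y [^] (2 * j + n + 1))))"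
    by (intro finsum_cong') simp_all
  \<comment> \<open>No bound on \<open>j\<close> appears: \<open>m - (2 * j + 1)\<close> is even for
    every \<open>j\<close>, being \<open>0\<close> once truncated.\<close>
  have "f (2 * j + 1) = e (2 * j + 1) \<odot>
      (x [^] (m - (2 * j + 1)) \<otimes> y [^] (n + (2 * j + 1)))" for j
    using pow_y_mult_monomial_even[of "m - (2 * j + 1)" n "2 * j + 1"] k
    by (simp only: f_def) simp
  then have odd_terms: "(\<Oplus>j\<in>{0..k}. f (2 * j + 1)) = (\<Oplus>j\<in>{0..k}. e (2 * j + 1) \<odot>
      (x [^] (m - (2 * j + 1)) \<otimes> y [^] (n + (2 * j + 1))))"
    by (simp only:)
  have "(\<Oplus>j\<in>{0..m}. f j) =
      (\<Oplus>j\<in>{0..k}. f (2 * j)) \<oplus> (\<Oplus>j\<in>{0..k}. f (2 * j + 1))"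
    unfolding k by (rule finsum_parity_split_odd) simp
  then show ?thesis
    unfolding even_terms odd_terms pow_y_mult_sum div by (simp only: f_def)
qed

end

section \<open>Transfer to \<open>Q_alg a (-1) c\<close>\<close>

theorem proposition2p2:
  fixes a c :: "'k::field_char_0" and n m :: nat and e :: "nat \<Rightarrow> 'k"
    and Q (structure) and x y :: "'k free_alg set"
  assumes Q: "Q = Q_alg a (-1) c"
    and x: "x = Q_gen a (-1) c Gen_x"
    and y: "y = Q_gen a (-1) c Gen_y"
    and ac: "a * c \<noteq> 1"
    and n: "odd n"
  shows "(even m \<longrightarrow>
      y [^] n \<otimes> (\<Oplus>j\<in>{0..m}. e j \<odot> (x [^] (m - j) \<otimes> y [^] j)) =
        (\<Oplus>j\<in>{0..m}. ((-1) ^ j * e j) \<odot> (x [^] (m - j) \<otimes> y [^] (n + j)))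
        \<oplus> (\<Oplus>j\<in>{0..<m div 2}. e (2 * j + 1) \<odot>
              (a \<odot> (x [^] (m - 2 * j) \<otimes> y [^] (n + 2 * j))
               \<oplus> c \<odot> (x [^] (m - (2 * j + 2)) \<otimes> y [^] (n + (2 * j + 2))))))
    \<and> (odd m \<longrightarrow>
      y [^] n \<otimes> (\<Oplus>j\<in>{0..m}. e j \<odot> (x [^] (m - j) \<otimes> y [^] j)) =
        (\<Oplus>j\<in>{0..m div 2}. e (2 * j) \<odot>
            (a \<odot> (x [^] (m - 2 * j + 1) \<otimes> y [^] (2 * j + n - 1))
             \<ominus> x [^] (m - 2 * j) \<otimes> y [^] (2 * j + n)
             \<oplus> c \<odot> (x [^] (m - (2 * j + 1)) \<otimes> y [^] (2 * j + n + 1))))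
        \<oplus> (\<Oplus>j\<in>{0..m div 2}. e (2 * j + 1) \<odot>
            (x [^] (m - (2 * j + 1)) \<otimes> y [^] (n + (2 * j + 1)))))"
proof -
  interpret assoc_algebra Q
    unfolding Q by (intro assoc_algebra.intro assoc_algebra_axioms.intro Q_module Q_ring Q_smult_assoc)
  have closed: "x \<in> carrier Q" "y \<in> carrier Q"
    by (simp_all add: x y Q Q_gen_def Q_coset)
  \<comment> \<open>In the defining relation with \<open>b = -1\<close>, squares become products and
    the scalar \<open>-1\<close> becomes a subtraction, as \<open>skew_relation\<close>
    requires.\<close>
  have "y \<otimes> x = a \<odot> (x \<otimes> x) \<ominus> x \<otimes> y \<oplus> c \<odot> (y \<otimes> y)"
    using Q_relation[of a "-1" c] closed
    by (simp add: numeral_2_eq_2 minus_eq smult_uminus_left smult_one[simplified] flip: Q x y)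
  then interpret skew_relation Q a c x y
    using closed ac
    by (intro skew_relation.intro skew_relation_axioms.intro assoc_algebra_axioms)
  show ?thesis
    by (intro conjI impI pow_y_mult_sum_even pow_y_mult_sum_odd n)
qed

end
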